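(* Consider the problem $$\begin{aligned} z^*=\min_{l,f,p,\theta}\quad &\sum_{b\in\mathcal B} l_b\\ \text{s.t.}\quad &\sum_{k\in\mathcal K_b^+} f_k-\sum_{k\in\mathcal K_b^-} f_k+\sum_{g\in\mathcal G_b}p_g+l_b=D_b &&\forall b\in\mathcal B\\ &f_k=B_k(\theta_{o(k)}-\theta_{d(k)}) &&\forall k\in\mathcal K\\ &-\overline F_k\le f_k\le\overline F_k &&\forall k\in\mathcal K\\ &0\le l_b\le D_b &&\forall b\in\mathcal B\\ &0\le p_g\le\overline P_g &&\forall g\in\mathcal G \end{aligned}$$ and its relaxation $$\begin{aligned} z^l=\min_{l,f,p}\quad &\sum_{b\in\mathcal B} l_b\\ \text{s.t.}\quad &\sum_{k\in\mathcal K_b^+} f_k-\sum_{k\in\mathcal K_b^-} f_k+\sum_{g\in\mathcal G_b}p_g+l_b=D_b &&\forall b\in\mathcal B\\ &-\overline F_k\le f_k\le\overline F_k &&\forall k\in\mathcal K\\ &0\le l_b\le D_b &&\forall b\in\mathcal B\\ &0\le p_g\le\overline P_g &&\forall g\in\mathcal G. \end{aligned}$$ Let $G(\mathcal B,\mathcal K)$ be the (connected) network digraph, let $\mathcal B=V^1\cup\cdots\cup V^m$ with $V^i\cap V^j=\emptyset$ for all $i\ne j$ be such that contracting, for each $i$, the nodes in $V^i$ into one node yields a tree, let $r(G):=\max_{1\le i\le m}|V^i|$, let $B_{\max}$ and $B_{\min}$ be the maximum and minimum susceptance, and let $D\in\mathbb R^{|\mathcal B|}$ be the vector of values $D_b$.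 If $$\overline F_k\ge\sqrt{\frac{B_{\max}}{B_{\min}}}\,\sqrt{r(G)-1}\,\|D\|_1\qquad\text{for all }k\in\mathcal K,$$ then $z^*=z^l$.
   Context: The power network is represented as a digraph $G(\mathcal B,\mathcal K)$ whose nodes are the buses $\mathcal B$ and whose arcs are the transmission lines $\mathcal K$; line $k$ goes from its origin bus $o(k)$ to its destination bus $d(k)$. $\mathcal K_b^+$ is the set of lines to bus $b$ and $\mathcal K_b^-$ the set of lines originating at bus $b$. $\mathcal G$ is the set of generators and $\mathcal G_b$ the set of generators at bus $b$; the paper assumes that there is exactly one generator per bus (a bus without a generator is given one of capacity $0$, and several generators at one bus are aggregated into one by summing capacities). Line $k$ has susceptance $B_k>0$ and thermal limit $\overline F_k\ge 0$; generator $g$ has maximum dispatch level $\overline P_g\ge 0$; bus $b$ has demand $D_b\ge 0$. The variables are the load sheds $l_b$, the line flows $f_k$, the generator dispatch levels $p_g$ and the phase angles $\theta_b$, all real; the phase angles are unbounded. "Connected" and "tree" refer to the underlying undirected graph; contraction removes arcs inside each $V^i$ and keeps all other arcs (parallel arcs are not merged). *)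

theory Defs
  imports Complex_Main "Graph_Theory.Digraph_Component"
begin

section \<open>Power networks\<close>

text \<open>The line \<open>k\<close> goes from \<open>tail (net N) k\<close> to \<open>head (net N) k\<close>, so that the lines to a bus \<open>b\<close>
  are \<open>in_arcs (net N) b\<close> and the lines originating there are \<open>out_arcs (net N) b\<close>.
  Parallel lines and loops are not excluded.\<close>

record ('b, 'k, 'g) power_network =
  net :: "('b, 'k) pre_digraph"
  gens :: "'g set"
  gen_bus :: "'g \<Rightarrow> 'b"
  susceptance :: "'k \<Rightarrow> real"
  thermal_limit :: "'k \<Rightarrow> real"
  max_dispatch :: "'g \<Rightarrow> real"
  demand :: "'b \<Rightarrow> real"

locale power_network =
  fixes N :: "('b, 'k, 'g) power_network"
  assumes fin_digraph_net: "fin_digraph (net N)"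
    and one_generator_per_bus: "bij_betw (gen_bus N) (gens N) (verts (net N))"
    and susceptance_pos: "\<And>k. k \<in> arcs (net N) \<Longrightarrow> susceptance N k > 0"
    and thermal_limit_nonneg: "\<And>k. k \<in> arcs (net N) \<Longrightarrow> thermal_limit N k \<ge> 0"
    and max_dispatch_nonneg: "\<And>g. g \<in> gens N \<Longrightarrow> max_dispatch N g \<ge> 0"
    and demand_nonneg: "\<And>b. b \<in> verts (net N) \<Longrightarrow> demand N b \<ge> 0"

text \<open>If the network has no line, the next two values are unspecified.\<close>

definition max_susceptance :: "('b, 'k, 'g) power_network \<Rightarrow> real" where
  "max_susceptance N = Max (susceptance N ` arcs (net N))"

definition min_susceptance :: "('b, 'k, 'g) power_network \<Rightarrow> real" where
  "min_susceptance N = Min (susceptance N ` arcs (net N))"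

definition demand_norm1 :: "('b, 'k, 'g) power_network \<Rightarrow> real" where
  "demand_norm1 N = (\<Sum>b\<in>verts (net N). \<bar>demand N b\<bar>)"


section \<open>The load shedding problem and its relaxation\<close>

definition relaxed_feasible ::
  "('b, 'k, 'g) power_network \<Rightarrow> ('b \<Rightarrow> real) \<Rightarrow> ('k \<Rightarrow> real) \<Rightarrow> ('g \<Rightarrow> real) \<Rightarrow> bool" where
  "relaxed_feasible N l f p \<longleftrightarrow>
     (\<forall>b\<in>verts (net N).
        (\<Sum>k\<in>in_arcs (net N) b. f k) - (\<Sum>k\<in>out_arcs (net N) b. f k)
        + (\<Sum>g\<in>{g \<in> gens N. gen_bus N g = b}. p g) + l b = demand N b) \<and>
     (\<forall>k\<in>arcs (net N). - thermal_limit N k \<le> f k \<and> f k \<le> thermal_limit N k) \<and>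
     (\<forall>b\<in>verts (net N). 0 \<le> l b \<and> l b \<le> demand N b) \<and>
     (\<forall>g\<in>gens N. 0 \<le> p g \<and> p g \<le> max_dispatch N g)"

definition dc_feasible ::
  "('b, 'k, 'g) power_network \<Rightarrow> ('b \<Rightarrow> real) \<Rightarrow> ('k \<Rightarrow> real) \<Rightarrow> ('g \<Rightarrow> real) \<Rightarrow> ('b \<Rightarrow> real) \<Rightarrow> bool"
  where
  "dc_feasible N l f p \<theta> \<longleftrightarrow>
     relaxed_feasible N l f p \<and>
     (\<forall>k\<in>arcs (net N). f k = susceptance N k * (\<theta> (tail (net N) k) - \<theta> (head (net N) k)))"

definition total_shed :: "('b, 'k, 'g) power_network \<Rightarrow> ('b \<Rightarrow> real) \<Rightarrow> real" where
  "total_shed N l = (\<Sum>b\<in>verts (net N). l b)"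

definition dc_sheds :: "('b, 'k, 'g) power_network \<Rightarrow> real set" where
  "dc_sheds N = {total_shed N l | l f p \<theta>. dc_feasible N l f p \<theta>}"

definition relaxed_sheds :: "('b, 'k, 'g) power_network \<Rightarrow> real set" where
  "relaxed_sheds N = {total_shed N l | l f p. relaxed_feasible N l f p}"

text \<open>Both sets are bounded below by 0, so each infimum is a minimum iff it belongs to its set.\<close>

definition dc_optimum :: "('b, 'k, 'g) power_network \<Rightarrow> real" where
  "dc_optimum N = Inf (dc_sheds N)"

definition relaxed_optimum :: "('b, 'k, 'g) power_network \<Rightarrow> real" where
  "relaxed_optimum N = Inf (relaxed_sheds N)"


section \<open>Undirected trees and contraction\<close>

text \<open>\<open>Digraph_Component.connected\<close> refers to the underlying undirected graph, but
  \<open>Digraph_Component.tree\<close> only forbids directed cycles and is not the notion needed here.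
  In an undirected cycle arcs may be traversed in either direction; a loop is a cycle of length 1
  and two distinct arcs with the same two ends form a cycle of length 2.\<close>

definition undirected_cycle :: "('a, 'b) pre_digraph \<Rightarrow> 'a list \<Rightarrow> 'b list \<Rightarrow> bool" where
  "undirected_cycle G vs es \<longleftrightarrow>
     es \<noteq> [] \<and> length vs = length es \<and> distinct vs \<and> distinct es \<and> set es \<subseteq> arcs G \<and>
     (\<forall>i<length es. {tail G (es ! i), head G (es ! i)} = {vs ! i, vs ! (Suc i mod length es)})"

definition undirected_tree :: "('a, 'b) pre_digraph \<Rightarrow> bool" where
  "undirected_tree G \<longleftrightarrow>
     Digraph_Component.connected G \<and> (\<nexists>vs es. undirected_cycle G vs es)"

text \<open>For pairwise disjoint \<open>V 1, \<dots>, V m\<close> covering the vertices, the vertices in \<open>V i\<close> are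
  contracted into the vertex \<open>i\<close>. Empty sets \<open>V i\<close> do not contribute a vertex.\<close>

definition part_index :: "(nat \<Rightarrow> 'a set) \<Rightarrow> nat \<Rightarrow> 'a \<Rightarrow> nat" where
  "part_index V m v = (THE i. i \<in> {1..m} \<and> v \<in> V i)"

definition contract :: "('a, 'b) pre_digraph \<Rightarrow> (nat \<Rightarrow> 'a set) \<Rightarrow> nat \<Rightarrow> (nat, 'b) pre_digraph" where
  "contract G V m =
     \<lparr> verts = part_index V m ` verts G,
       arcs = {e \<in> arcs G. part_index V m (tail G e) \<noteq> part_index V m (head G e)},
       tail = (\<lambda>e. part_index V m (tail G e)),
       head = (\<lambda>e. part_index V m (head G e)) \<rparr>"

end

theory Submission
  imports Defs "HOL-Analysis.Function_Topology"
begin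

text \<open>Every dispatch and load shed that is feasible for the relaxation is feasible for the original
  problem, with another flow. Hence both problems have the same set of objective values, and only
  the relaxed minimum has to be shown to exist, which is a compactness argument
  (\<open>relaxed_minimum_attained\<close>).

  Let \<open>f\<close> be a relaxed flow. Fixing the dispatch and the load shed fixes the net outflow of every bus,
  and on a connected network exactly one flow \<open>f'\<close> with these net outflows comes from phase angles
  (\<open>ex_potential_flow\<close> gives its existence). The point is that \<open>f'\<close> respects the thermal limits.

  On a line between two different parts, \<open>f' = f\<close>: the contracted graph has no undirected cycle, so
  this line is the only one across some cut, and its flow is the net outflow of one side
  (\<open>circulation_0_between_parts\<close>).

  On a line \<open>e\<close> inside a part \<open>U\<close>, compare \<open>f'\<close> with a flow \<open>g\<close> that has the same net outflows and whose
  support is a forest (\<open>ex_circulation_free_flow\<close>). The flows \<open>f'\<close> and \<open>g\<close> agree on the lines that leave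
  \<open>U\<close>, and among the flows with given values there and given net outflows, the one that comes from
  potentials has the least energy inside \<open>U\<close> (\<open>block_energy_le\<close>). So \<open>(f' e)\<^sup>2 / B\<^sub>e\<close> is at most the energy
  of \<open>g\<close> inside \<open>U\<close>. There \<open>g\<close> uses at most \<open>card U - 1\<close> lines (\<open>circulation_free_card\<close>), and on each
  of them its absolute value is at most the total demand: this value is the absolute net outflow of
  a set of buses (\<open>circulation_free_flow_bound\<close>), and such a set neither absorbs nor emits more than
  the total demand (\<open>cut_injection_le_demand\<close>). Taking square roots gives the assumed bound on the limits.\<close>

section \<open>Homogeneous linear systems\<close>

text \<open>Gaussian elimination: an equation with a nonzero coefficient at \<open>a0\<close> is solved for the unknown \<open>a0\<close>
  and substituted into the others. This replaces all dimension arguments below: it gives the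
  potentials as well as the bound on the number of arcs of a forest.\<close>

lemma underdetermined_system_nontrivial:
  fixes M :: "'e \<Rightarrow> 'a \<Rightarrow> 'r::field"
  assumes "finite E" "finite A" "card E < card A"
  shows "\<exists>x. (\<exists>a\<in>A. x a \<noteq> 0) \<and> (\<forall>a. a \<notin> A \<longrightarrow> x a = 0) \<and> (\<forall>e\<in>E. (\<Sum>a\<in>A. M e a * x a) = 0)"
  using assms
proof (induction E arbitrary: A M rule: finite_induct)
  case empty
  then obtain a where "a \<in> A" by fastforce
  then show ?case
    by (intro exI[of _ "\<lambda>b. if b = a then 1 else 0"]) auto
next
  case (insert e E)
  show ?case
  proof (cases "\<forall>a\<in>A. M e a = 0")
    case True
    have "card E < card A" using insert by simp
    from insert.IH[OF insert.prems(1) this, of M] show ?thesis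
      using True by auto
  next
    case False
    then obtain a0 where a0: "a0 \<in> A" "M e a0 \<noteq> 0" by blast
    let ?A = "A - {a0}"
    let ?M = "\<lambda>e' a. M e' a - M e' a0 * M e a / M e a0"
    have "card E < card ?A" "finite ?A" using insert a0 by auto
    from insert.IH[OF this(2,1), of ?M] obtain y
      where y: "\<exists>a\<in>?A. y a \<noteq> 0" "\<And>a. a \<notin> ?A \<Longrightarrow> y a = 0"
        "\<And>e'. e' \<in> E \<Longrightarrow> (\<Sum>a\<in>?A. ?M e' a * y a) = 0" by blast
    define c where "c = (\<Sum>a\<in>?A. M e a * y a)"
    define x where "x = y(a0 := - c / M e a0)"
    have split: "(\<Sum>a\<in>A. M e' a * x a) = M e' a0 * (- c / M e a0) + (\<Sum>a\<in>?A. M e' a * y a)" for e'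
    proof -
      have "(\<Sum>a\<in>A. M e' a * x a) = M e' a0 * x a0 + (\<Sum>a\<in>?A. M e' a * x a)"
        using a0 insert.prems(1) by (simp add: sum.remove)
      also have "(\<Sum>a\<in>?A. M e' a * x a) = (\<Sum>a\<in>?A. M e' a * y a)"
        by (rule sum.cong) (auto simp: x_def)
      finally show ?thesis by (simp add: x_def)
    qed
    have "(\<Sum>a\<in>A. M e' a * x a) = 0" if "e' \<in> insert e E" for e'
    proof (cases "e' = e")
      case True
      then show ?thesis using a0 split[of e] by (simp add: c_def)
    next
      case False
      then have "(\<Sum>a\<in>?A. ?M e' a * y a) = 0" using that y(3) by blast
      moreover have "(\<Sum>a\<in>?A. ?M e' a * y a)
          = (\<Sum>a\<in>?A. M e' a * y a) - (\<Sum>a\<in>?A. (M e' a0 / M e a0) * (M e a * y a))"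
        unfolding sum_subtractf[symmetric] by (rule sum.cong) (auto simp: field_simps)
      moreover have "(\<Sum>a\<in>?A. (M e' a0 / M e a0) * (M e a * y a)) = M e' a0 / M e a0 * c"
        unfolding c_def sum_distrib_left ..
      ultimately show ?thesis using split[of e'] by simp
    qed
    moreover have "\<exists>a\<in>A. x a \<noteq> 0" using y(1) by (auto simp: x_def)
    moreover have "\<forall>a. a \<notin> A \<longrightarrow> x a = 0" using y(2) a0 by (auto simp: x_def)
    ultimately show ?thesis by blast
  qed
qed

section \<open>Flows and circulations\<close>

definition net_outflow :: "('a, 'b) pre_digraph \<Rightarrow> ('b \<Rightarrow> real) \<Rightarrow> 'a \<Rightarrow> real" where
  "net_outflow G f v = (\<Sum>k\<in>out_arcs G v. f k) - (\<Sum>k\<in>in_arcs G v. f k)"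

text \<open>Reachability along these pairs is reachability by arcs in \<open>A\<close>, each traversed in either direction.\<close>

definition links :: "('a, 'b) pre_digraph \<Rightarrow> 'b set \<Rightarrow> ('a \<times> 'a) set" where
  "links G A = (\<Union>k\<in>A. {(tail G k, head G k), (head G k, tail G k)})"

text \<open>A set of arcs without an undirected cycle, that is, a forest, characterised by its cycle space. A
  loop is a circulation by itself, so it cannot belong to such a set.\<close>

definition circulation_free :: "('a, 'b) pre_digraph \<Rightarrow> 'b set \<Rightarrow> bool" where
  "circulation_free G A \<longleftrightarrow>
     (\<forall>h. (\<forall>k. k \<notin> A \<longrightarrow> h k = 0) \<longrightarrow> (\<forall>v\<in>verts G. net_outflow G h v = 0) \<longrightarrow> (\<forall>k. h k = 0))"

lemma links_closed:
  "k \<in> A \<Longrightarrow> (u, tail G k) \<in> (links G A)\<^sup>* \<longleftrightarrow> (u, head G k) \<in> (links G A)\<^sup>*"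
  unfolding links_def by (auto intro: rtrancl_into_rtrancl)

context fin_digraph
begin

lemma net_outflow_incidence:
  "net_outflow G f v = (\<Sum>k\<in>arcs G. (of_bool (tail G k = v) - of_bool (head G k = v)) * f k)"
proof -
  have "(\<Sum>k\<in>out_arcs G v. f k) = (\<Sum>k\<in>arcs G. of_bool (tail G k = v) * f k)"
    unfolding out_arcs_def by (intro sum.mono_neutral_cong_left) auto
  moreover have "(\<Sum>k\<in>in_arcs G v. f k) = (\<Sum>k\<in>arcs G. of_bool (head G k = v) * f k)"
    unfolding in_arcs_def by (intro sum.mono_neutral_cong_left) auto
  ultimately show ?thesis
    by (simp add: net_outflow_def left_diff_distrib sum_subtractf)
qed

lemma net_outflow_diff_scale:
  "net_outflow G (\<lambda>k. f k - c * g k) v = net_outflow G f v - c * net_outflow G g v"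
  unfolding net_outflow_incidence sum_distrib_left sum_subtractf[symmetric]
  by (rule sum.cong) (auto simp: algebra_simps)

lemma net_outflow_diff:
  "net_outflow G (\<lambda>k. f k - g k) v = net_outflow G f v - net_outflow G g v"
  using net_outflow_diff_scale[of f 1 g v] by simp

lemma net_outflow_single:
  assumes "e \<in> arcs G"
  shows "net_outflow G (\<lambda>k. if k = e then c else 0) v
           = (of_bool (tail G e = v) - of_bool (head G e = v)) * c"
proof -
  have "net_outflow G (\<lambda>k. if k = e then c else 0) v
      = (\<Sum>k\<in>arcs G. if k = e then (of_bool (tail G k = v) - of_bool (head G k = v)) * c else 0)"
    unfolding net_outflow_incidence by (rule sum.cong) auto
  then show ?thesis using assms by simp
qed

text \<open>The only link between vertices and arcs that the proof needs: indicator functions \<open>\<phi>\<close> give the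
  conservation law across a cut, and potentials \<open>\<phi>\<close> give the orthogonality of potential
  differences and circulations.\<close>

lemma summation_by_parts:
  "(\<Sum>v\<in>verts G. \<phi> v * net_outflow G f v) = (\<Sum>k\<in>arcs G. (\<phi> (tail G k) - \<phi> (head G k)) * f k)"
proof -
  have "(\<Sum>v\<in>verts G. \<phi> v * net_outflow G f v)
      = (\<Sum>k\<in>arcs G. \<Sum>v\<in>verts G. \<phi> v * ((of_bool (tail G k = v) - of_bool (head G k = v)) * f k))"
    unfolding net_outflow_incidence sum_distrib_left by (rule sum.swap)
  also have "\<dots> = (\<Sum>k\<in>arcs G. (\<phi> (tail G k) - \<phi> (head G k)) * f k)"
  proof (rule sum.cong[OF refl])
    fix k assume k: "k \<in> arcs G"
    have "(\<Sum>v\<in>verts G. \<phi> v * ((of_bool (tail G k = v) - of_bool (head G k = v)) * f k))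
        = (\<Sum>v\<in>verts G. (if tail G k = v then \<phi> v * f k else 0) - (if head G k = v then \<phi> v * f k else 0))"
      by (rule sum.cong) auto
    also have "\<dots> = (\<phi> (tail G k) - \<phi> (head G k)) * f k"
      using k by (simp add: sum_subtractf left_diff_distrib)
    finally show "(\<Sum>v\<in>verts G. \<phi> v * ((of_bool (tail G k = v) - of_bool (head G k = v)) * f k))
      = (\<phi> (tail G k) - \<phi> (head G k)) * f k" .
  qed
  finally show ?thesis .
qed

lemma sum_net_outflow_eq_0: "(\<Sum>v\<in>verts G. net_outflow G f v) = 0"
  using summation_by_parts[of "\<lambda>_. 1" f] by simp

lemma flow_on_single_crossing_arc:
  assumes "S \<subseteq> verts G" "e \<in> arcs G" "(tail G e \<in> S) \<noteq> (head G e \<in> S)"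
    and "\<And>k. k \<in> arcs G \<Longrightarrow> k \<noteq> e \<Longrightarrow> (tail G k \<in> S) \<noteq> (head G k \<in> S) \<Longrightarrow> f k = 0"
  shows "\<bar>f e\<bar> = \<bar>\<Sum>v\<in>S. net_outflow G f v\<bar>"
proof -
  have "(\<Sum>v\<in>S. net_outflow G f v) = (\<Sum>v\<in>verts G. of_bool (v \<in> S) * net_outflow G f v)"
    using assms(1) by (intro sum.mono_neutral_cong_left) auto
  also have "\<dots> = (\<Sum>k\<in>arcs G. (of_bool (tail G k \<in> S) - of_bool (head G k \<in> S)) * f k)"
    by (rule summation_by_parts)
  also have "\<dots> = (\<Sum>k\<in>{e}. (of_bool (tail G k \<in> S) - of_bool (head G k \<in> S)) * f k)"
    using assms(2,4) by (intro sum.mono_neutral_right) (auto simp: of_bool_def)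
  finally show ?thesis using assms(3) by auto
qed

lemma unit_flow_along_links:
  assumes "(u, v) \<in> (links G A)\<^sup>*" "A \<subseteq> arcs G"
  shows "\<exists>f. (\<forall>k. k \<notin> A \<longrightarrow> f k = 0) \<and> (\<forall>w. net_outflow G f w = of_bool (w = u) - of_bool (w = v))"
  using assms(1)
proof (induction rule: rtrancl_induct)
  case base
  then show ?case by (intro exI[of _ "\<lambda>_. 0"]) (auto simp: net_outflow_def)
next
  case (step v w)
  then obtain f where f: "\<And>k. k \<notin> A \<Longrightarrow> f k = 0"
    "\<And>x. net_outflow G f x = of_bool (x = u) - of_bool (x = v)" by blast
  from step(2) obtain e c where e: "e \<in> A"
    and c: "\<And>x. (of_bool (tail G e = x) - of_bool (head G e = x)) * c = (of_bool (x = w) - of_bool (x = v) :: real)"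
  proof -
    from step(2) obtain e where "e \<in> A" "(v, w) = (tail G e, head G e) \<or> (v, w) = (head G e, tail G e)"
      unfolding links_def by blast
    then show thesis
      using that[of e "-1"] that[of e 1] by auto
  qed
  let ?f = "\<lambda>k. f k - 1 * (if k = e then c else 0)"
  have "e \<in> arcs G" using e assms(2) by blast
  then have "net_outflow G ?f x = of_bool (x = u) - of_bool (x = w)" for x
    unfolding net_outflow_diff_scale net_outflow_single[OF \<open>e \<in> arcs G\<close>] f(2) c by simp
  moreover have "\<forall>k. k \<notin> A \<longrightarrow> ?f k = 0" using f e by auto
  ultimately show ?case by (intro exI[of _ ?f]) simp
qed

text \<open>A walk back from the head of \<open>e\<close> to its tail would carry a unit flow that \<open>e\<close> closes to a circulation.\<close>

lemma circulation_free_no_return: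
  assumes "circulation_free G A" "A \<subseteq> arcs G" "e \<in> A"
  shows "(head G e, tail G e) \<notin> (links G (A - {e}))\<^sup>*"
proof
  assume "(head G e, tail G e) \<in> (links G (A - {e}))\<^sup>*"
  from unit_flow_along_links[OF this] assms(2) obtain f
    where f: "\<And>k. k \<notin> A - {e} \<Longrightarrow> f k = 0"
      "\<And>x. net_outflow G f x = of_bool (x = head G e) - of_bool (x = tail G e)" by blast
  let ?h = "\<lambda>k. f k - 1 * (if k = e then -1 else 0)"
  have "e \<in> arcs G" using assms by blast
  then have "net_outflow G ?h x = 0" for x
    unfolding net_outflow_diff_scale net_outflow_single[OF \<open>e \<in> arcs G\<close>] f(2) by auto
  moreover have "\<forall>k. k \<notin> A \<longrightarrow> ?h k = 0" using f assms(3) by auto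
  ultimately have "?h e = 0"
    using assms(1)[unfolded circulation_free_def, rule_format, of ?h e] by simp
  then show False using f(1)[of e] by simp
qed

lemma links_closed_verts:
  assumes "A \<subseteq> arcs G" "(u, v) \<in> (links G A)\<^sup>*" "u \<in> verts G"
  shows "v \<in> verts G"
  using assms(2,3) by (induction rule: rtrancl_induct) (use assms(1) in \<open>auto simp: links_def\<close>)

text \<open>Without \<open>e\<close>, the vertices reachable from its head in the support form a set that \<open>e\<close>, and no other arc
  with nonzero flow, crosses. So the flow on \<open>e\<close> is, up to sign, the net outflow of this set.\<close>

lemma circulation_free_flow_bound:
  assumes free: "circulation_free G {k \<in> arcs G. g k \<noteq> 0}"
    and bound: "\<And>S. S \<subseteq> verts G \<Longrightarrow> \<bar>\<Sum>v\<in>S. net_outflow G g v\<bar> \<le> c"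
    and "e \<in> arcs G"
  shows "\<bar>g e\<bar> \<le> c"
proof (cases "g e = 0")
  case True
  then show ?thesis using bound[of "{}"] by simp
next
  case False
  let ?A = "{k \<in> arcs G. g k \<noteq> 0}"
  let ?S = "(links G (?A - {e}))\<^sup>* `` {head G e}"
  have e: "e \<in> ?A" using False assms(3) by simp
  have A: "?A - {e} \<subseteq> arcs G" by blast
  have sub: "?S \<subseteq> verts G"
    using links_closed_verts[OF A] head_in_verts[OF assms(3)] by (meson Image_singleton_iff subsetI)
  have "tail G e \<notin> ?S" using circulation_free_no_return[OF free _ e] by (simp add: subset_iff)
  moreover have "head G e \<in> ?S" by simp
  moreover have "g k = 0" if "k \<in> arcs G" "k \<noteq> e" "(tail G k \<in> ?S) \<noteq> (head G k \<in> ?S)" for k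
  proof (rule ccontr)
    assume "g k \<noteq> 0"
    then have "k \<in> ?A - {e}" using that by simp
    from links_closed[OF this, of "head G e" G] show False using that(3) by simp
  qed
  ultimately have "\<bar>g e\<bar> = \<bar>\<Sum>v\<in>?S. net_outflow G g v\<bar>"
    by (intro flow_on_single_crossing_arc[OF sub assms(3)]) argo
  then show ?thesis using bound[OF sub] by simp
qed

text \<open>Conservation at all but one vertex \<open>u\<close> of \<open>U\<close> implies conservation at \<open>u\<close>, because the net outflows
  sum to zero. So \<open>card U\<close> or more arcs would leave more unknowns than equations, and hence a
  nonzero circulation.\<close>

lemma circulation_free_card:
  assumes free: "circulation_free G A" and "A \<subseteq> arcs G"
    and ends: "\<And>k. k \<in> A \<Longrightarrow> tail G k \<in> U \<and> head G k \<in> U"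
    and "finite U" "U \<noteq> {}"
  shows "card A \<le> card U - 1"
proof (rule ccontr)
  assume "\<not> card A \<le> card U - 1"
  obtain u where u: "u \<in> U" using assms by blast
  have "finite A" using assms(2) finite_subset finite_arcs by blast
  have "card (U - {u}) < card A" using \<open>\<not> card A \<le> card U - 1\<close> u assms(4) by simp
  from underdetermined_system_nontrivial[OF _ \<open>finite A\<close> this,
      of "\<lambda>v k. of_bool (tail G k = v) - of_bool (head G k = v) :: real"] assms(4)
  obtain x :: "'b \<Rightarrow> real" where x: "\<exists>a\<in>A. x a \<noteq> 0" "\<And>a. a \<notin> A \<Longrightarrow> x a = 0"
    "\<And>v. v \<in> U - {u} \<Longrightarrow> (\<Sum>k\<in>A. (of_bool (tail G k = v) - of_bool (head G k = v)) * x k) = 0"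
    by blast
  have on_A: "net_outflow G x v = (\<Sum>k\<in>A. (of_bool (tail G k = v) - of_bool (head G k = v)) * x k)" for v
    unfolding net_outflow_incidence using assms(2) x(2) by (intro sum.mono_neutral_right) auto
  have off_u: "net_outflow G x v = 0" if "v \<noteq> u" for v
  proof (cases "v \<in> U")
    case True
    then show ?thesis using x(3) on_A that by simp
  next
    case False
    then show ?thesis unfolding on_A using ends by (intro sum.neutral) auto
  qed
  have "net_outflow G x u = 0" if "u \<in> verts G"
    using sum_net_outflow_eq_0[of x] that off_u by (simp add: sum.remove[OF finite_verts that])
  then have "\<forall>v\<in>verts G. net_outflow G x v = 0" using off_u by metis
  then show False using free x(1,2) unfolding circulation_free_def by blast
qed

text \<open>In a flow of smallest support, a nonzero circulation on the support could be subtracted with a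
  factor that cancels the flow on one arc.\<close>

lemma ex_circulation_free_flow:
  "\<exists>g. circulation_free G {k \<in> arcs G. g k \<noteq> 0} \<and> (\<forall>v\<in>verts G. net_outflow G g v = net_outflow G f v)"
proof -
  let ?P = "\<lambda>g. \<forall>v\<in>verts G. net_outflow G g v = net_outflow G f v"
  let ?supp = "\<lambda>g. {k \<in> arcs G. g k \<noteq> (0::real)}"
  have "?P f" by simp
  then obtain g where g: "?P g" and least: "\<And>g'. ?P g' \<Longrightarrow> card (?supp g) \<le> card (?supp g')"
    using ex_has_least_nat[of ?P f "\<lambda>g. card (?supp g)"] by blast
  have "circulation_free G (?supp g)"
    unfolding circulation_free_def
  proof (rule ccontr, clarsimp)
    fix h e assume h: "\<forall>k. (k \<in> arcs G \<longrightarrow> g k = 0) \<longrightarrow> h k = 0"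
      "\<forall>v\<in>verts G. net_outflow G h v = 0" "h e \<noteq> 0"
    let ?g = "\<lambda>k. g k - g e / h e * h k"
    have "?P ?g" unfolding net_outflow_diff_scale using g h(2) by simp
    moreover have "?supp ?g \<subset> ?supp g"
    proof
      show "?supp ?g \<subseteq> ?supp g" using h(1) by auto
      have "e \<in> ?supp g" "e \<notin> ?supp ?g" using h(1,3) by auto
      then show "?supp ?g \<noteq> ?supp g" by blast
    qed
    then have "card (?supp ?g) < card (?supp g)" by (intro psubset_card_mono) auto
    ultimately show False using least[of ?g] by simp
  qed
  with g show ?thesis by blast
qed

section \<open>Flows that come from potentials\<close>

lemma connected_imp_potential_constant:
  assumes "Digraph_Component.connected G"
    and step: "\<And>k. k \<in> arcs G \<Longrightarrow> \<theta> (tail G k) = \<theta> (head G k)"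
    and "u \<in> verts G" "v \<in> verts G"
  shows "\<theta> u = \<theta> v"
proof -
  have "u \<rightarrow>\<^sup>*\<^bsub>with_proj (mk_symmetric G)\<^esub> v"
    using assms unfolding Digraph_Component.connected_def strongly_connected_def by simp
  then have "(u, v) \<in> rtrancl_on (verts G) (parcs (mk_symmetric G))"
    unfolding reachable_def by simp
  then show ?thesis
    by (induction rule: rtrancl_on_induct) (auto simp: parcs_mk_symmetric step)
qed

text \<open>The equations \<open>L \<theta> = t s\<close> at all vertices but a root \<open>r\<close>, where \<open>L\<close> is the weighted Laplacian, together
  with \<open>\<theta> r = 0\<close>, have one more unknown than equations, as the scalar \<open>t\<close> is unknown too. In a nonzero
  solution \<open>t\<close> cannot be zero: then \<open>\<theta>\<close> would have energy zero and so be constant, hence zero.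
  Therefore \<open>\<theta> / t\<close> is the required potential.\<close>

lemma ex_potential_flow:
  assumes conn: "Digraph_Component.connected G"
    and pos: "\<And>k. k \<in> arcs G \<Longrightarrow> \<beta> k > 0"
    and zero: "(\<Sum>v\<in>verts G. s v) = 0"
  shows "\<exists>\<theta>. \<forall>v\<in>verts G. net_outflow G (\<lambda>k. \<beta> k * (\<theta> (tail G k) - \<theta> (head G k))) v = s v"
proof -
  define L where "L \<theta> = net_outflow G (\<lambda>k. \<beta> k * (\<theta> (tail G k) - \<theta> (head G k)))" for \<theta>
  have L_sum: "L \<theta> v = (\<Sum>c\<in>verts G. L (\<lambda>b. of_bool (b = c)) v * \<theta> c)" for \<theta> v
  proof -
    let ?i = "\<lambda>k. of_bool (tail G k = v) - of_bool (head G k = v) :: real"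
    have expand: "(\<Sum>c\<in>verts G. of_bool (w = c) * \<theta> c) = \<theta> w" if "w \<in> verts G" for w
    proof -
      have "(\<Sum>c\<in>verts G. of_bool (w = c) * \<theta> c) = (\<Sum>c\<in>verts G. if w = c then \<theta> c else 0)"
        by (rule sum.cong) auto
      then show ?thesis using that by simp
    qed
    have "(\<Sum>c\<in>verts G. L (\<lambda>b. of_bool (b = c)) v * \<theta> c)
       = (\<Sum>k\<in>arcs G. \<Sum>c\<in>verts G. ?i k * (\<beta> k * (of_bool (tail G k = c) - of_bool (head G k = c))) * \<theta> c)"
      unfolding L_def net_outflow_incidence sum_distrib_right by (rule sum.swap)
    also have "\<dots> = (\<Sum>k\<in>arcs G. ?i k * (\<beta> k * ((\<Sum>c\<in>verts G. of_bool (tail G k = c) * \<theta> c)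
        - (\<Sum>c\<in>verts G. of_bool (head G k = c) * \<theta> c))))"
      unfolding sum_subtractf[symmetric] sum_distrib_left
      by (intro sum.cong refl) (simp add: algebra_simps)
    also have "\<dots> = L \<theta> v"
      unfolding L_def net_outflow_incidence by (rule sum.cong) (simp_all add: expand)
    finally show ?thesis ..
  qed
  obtain r where r: "r \<in> verts G"
    using conn unfolding Digraph_Component.connected_def strongly_connected_def by auto
  have all_if_off_root: "\<forall>v\<in>verts G. L \<theta> v = s' v"
    if "\<forall>v\<in>verts G - {r}. L \<theta> v = s' v" "(\<Sum>v\<in>verts G. s' v) = 0" for \<theta> s'
  proof -
    have "L \<theta> r = - (\<Sum>v\<in>verts G - {r}. L \<theta> v)"
      using sum_net_outflow_eq_0[of "\<lambda>k. \<beta> k * (\<theta> (tail G k) - \<theta> (head G k))"]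
      by (simp add: L_def sum.remove[OF finite_verts r])
    also have "\<dots> = - (\<Sum>v\<in>verts G - {r}. s' v)" using that(1) by simp
    also have "\<dots> = s' r" using that(2) by (simp add: sum.remove[OF finite_verts r])
    finally show ?thesis using that(1) by blast
  qed
  (* None stands for the scalar t, and the equation of the root r is replaced by potential 0 at r. *)
  define M where "M v c = (case c of
      None \<Rightarrow> if v = r then 0 else - s v
    | Some w \<Rightarrow> if v = r then of_bool (w = r) else L (\<lambda>b. of_bool (b = w)) v)" for v c
  let ?A = "insert None (Some ` verts G)"
  have "card (verts G) < card ?A" by (simp add: card_image)
  from underdetermined_system_nontrivial[OF finite_verts _ this, of M]
  obtain x where x: "\<exists>a\<in>?A. x a \<noteq> 0" "\<And>v. v \<in> verts G \<Longrightarrow> (\<Sum>a\<in>?A. M v a * x a) = 0"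
    by auto
  define \<theta> t where "\<theta> = (\<lambda>v. x (Some v))" and "t = x None"
  have split: "(\<Sum>a\<in>?A. M v a * x a) = M v None * t + (\<Sum>w\<in>verts G. M v (Some w) * \<theta> w)" for v
    by (subst sum.insert) (auto simp: sum.reindex \<theta>_def t_def)
  have root: "\<theta> r = 0"
  proof -
    have "(\<Sum>w\<in>verts G. M r (Some w) * \<theta> w) = (\<Sum>w\<in>verts G. if w = r then \<theta> w else 0)"
      by (rule sum.cong) (auto simp: M_def)
    then show ?thesis using x(2)[OF r] r unfolding split by (simp add: M_def)
  qed
  have rest: "L \<theta> v = t * s v" if "v \<in> verts G - {r}" for v
  proof -
    have "(\<Sum>w\<in>verts G. M v (Some w) * \<theta> w) = L \<theta> v"
      unfolding L_sum[of \<theta>] using that by (intro sum.cong) (auto simp: M_def)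
    then show ?thesis using x(2)[of v] that unfolding split by (simp add: M_def)
  qed
  have L\<theta>: "\<forall>v\<in>verts G. L \<theta> v = t * s v"
    using rest zero by (intro all_if_off_root) (auto simp: sum_distrib_left[symmetric])
  have "t \<noteq> 0"
  proof
    assume "t = 0"
    then have "0 = (\<Sum>v\<in>verts G. \<theta> v * L \<theta> v)" using L\<theta> by simp
    also have "\<dots> = (\<Sum>k\<in>arcs G. \<beta> k * (\<theta> (tail G k) - \<theta> (head G k))\<^sup>2)"
      unfolding L_def summation_by_parts by (rule sum.cong) (auto simp: power2_eq_square)
    finally have "\<forall>k\<in>arcs G. \<beta> k * (\<theta> (tail G k) - \<theta> (head G k))\<^sup>2 = 0"
      by (subst (asm) eq_commute, subst (asm) sum_nonneg_eq_0_iff) (use pos in \<open>auto simp: less_imp_le\<close>)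
    then have "\<And>k. k \<in> arcs G \<Longrightarrow> \<theta> (tail G k) = \<theta> (head G k)" using pos by fastforce
    then have "\<theta> v = 0" if "v \<in> verts G" for v
      using connected_imp_potential_constant[OF conn, of \<theta> v r] that r root by simp
    then show False using x(1) \<open>t = 0\<close> by (auto simp: \<theta>_def t_def)
  qed
  have "L (\<lambda>v. \<theta> v / t) v = s v" if "v \<in> verts G" for v
  proof -
    have "L (\<lambda>v. \<theta> v / t) v = L \<theta> v / t"
      unfolding L_def net_outflow_incidence sum_divide_distrib
      by (rule sum.cong) (auto simp: field_simps diff_divide_distrib)
    then show ?thesis using L\<theta> that \<open>t \<noteq> 0\<close> by simp
  qed
  then show ?thesis unfolding L_def by (intro exI[of _ "\<lambda>v. \<theta> v / t"]) simp
qed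


text \<open>Thomson's principle for a part of a graph. On the arcs inside \<open>U\<close> the difference \<open>f - g\<close> is a
  circulation, hence orthogonal to the potential differences \<open>f k / \<beta> k\<close>; then
  \<open>f\<^sup>2 - g\<^sup>2 = 2 f (f - g) - (f - g)\<^sup>2\<close> gives the inequality.\<close>

lemma block_energy_le:
  assumes pos: "\<And>k. k \<in> arcs G \<Longrightarrow> \<beta> k > 0"
    and potential: "\<And>k. k \<in> arcs G \<Longrightarrow> f k = \<beta> k * (\<theta> (tail G k) - \<theta> (head G k))"
    and same: "\<And>v. v \<in> verts G \<Longrightarrow> net_outflow G f v = net_outflow G g v"
    and boundary: "\<And>k. k \<in> arcs G \<Longrightarrow> (tail G k \<in> U) \<noteq> (head G k \<in> U) \<Longrightarrow> f k = g k"
  defines "A \<equiv> {k \<in> arcs G. tail G k \<in> U \<and> head G k \<in> U}"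
  shows "(\<Sum>k\<in>A. (f k)\<^sup>2 / \<beta> k) \<le> (\<Sum>k\<in>A. (g k)\<^sup>2 / \<beta> k)"
proof -
  (* Cut off outside U, the potential keeps its differences inside U and has none outside;
     on the boundary of U the factor f - g vanishes. *)
  define \<phi> where "\<phi> v = (if v \<in> U then \<theta> v else 0)" for v
  have "0 = (\<Sum>v\<in>verts G. \<phi> v * net_outflow G (\<lambda>k. f k - g k) v)"
    unfolding net_outflow_diff by (simp add: same)
  also have "\<dots> = (\<Sum>k\<in>arcs G. (\<phi> (tail G k) - \<phi> (head G k)) * (f k - g k))"
    by (rule summation_by_parts)
  also have "\<dots> = (\<Sum>k\<in>A. f k * (f k - g k) / \<beta> k)"
  proof (rule sum.mono_neutral_cong_right)
    show "\<forall>k\<in>arcs G - A. (\<phi> (tail G k) - \<phi> (head G k)) * (f k - g k) = 0"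
      using boundary by (auto simp: A_def \<phi>_def)
    show "(\<phi> (tail G k) - \<phi> (head G k)) * (f k - g k) = f k * (f k - g k) / \<beta> k" if "k \<in> A" for k
    proof -
      have "\<phi> (tail G k) - \<phi> (head G k) = f k / \<beta> k"
        using that pos[of k] by (auto simp: A_def \<phi>_def potential)
      then show ?thesis by simp
    qed
  qed (auto simp: A_def)
  finally have orth: "(\<Sum>k\<in>A. f k * (f k - g k) / \<beta> k) = 0" ..
  have "(\<Sum>k\<in>A. (f k)\<^sup>2 / \<beta> k) - (\<Sum>k\<in>A. (g k)\<^sup>2 / \<beta> k)
      = (\<Sum>k\<in>A. ((f k)\<^sup>2 - (g k)\<^sup>2) / \<beta> k)"
    by (simp add: sum_subtractf diff_divide_distrib)
  also have "\<dots> \<le> (\<Sum>k\<in>A. 2 * (f k * (f k - g k) / \<beta> k))"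
  proof (rule sum_mono)
    fix k assume "k \<in> A"
    then have "\<beta> k > 0" using pos by (simp add: A_def)
    have "(f k)\<^sup>2 - (g k)\<^sup>2 \<le> 2 * (f k * (f k - g k))"
      using zero_le_power2[of "f k - g k"] by (simp add: power2_eq_square algebra_simps)
    then show "((f k)\<^sup>2 - (g k)\<^sup>2) / \<beta> k \<le> 2 * (f k * (f k - g k) / \<beta> k)"
      using divide_right_mono[of _ _ "\<beta> k"] \<open>\<beta> k > 0\<close> by fastforce
  qed
  also have "\<dots> = 0" unfolding sum_distrib_left[symmetric] orth by simp
  finally show ?thesis by simp
qed

end

section \<open>Arcs between the parts of a contraction\<close>

lemma links_simple_path:
  assumes "(u, v) \<in> (links G A)\<^sup>*"
  shows "\<exists>vs es. length vs = Suc (length es) \<and> distinct vs \<and> vs ! 0 = u \<and> vs ! length es = v \<and>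
    set es \<subseteq> A \<and> (\<forall>i<length es. {tail G (es ! i), head G (es ! i)} = {vs ! i, vs ! Suc i})"
  using assms
  proof (induction rule: rtrancl_induct)
    case base
    show ?case by (intro exI[of _ "[u]"] exI[of _ "[]"]) auto
  next
    case (step v w)
    then obtain vs es where p: "length vs = Suc (length es)" "distinct vs" "vs ! 0 = u"
      "vs ! length es = v" "set es \<subseteq> A"
      "\<And>i. i < length es \<Longrightarrow> {tail G (es ! i), head G (es ! i)} = {vs ! i, vs ! Suc i}" by blast
    show ?case
    proof (cases "w \<in> set vs")
      case True
      then obtain j where "j \<le> length es" "vs ! j = w"
        using p(1) by (metis in_set_conv_nth less_Suc_eq_le)
      then show ?thesis using p set_take_subset[of j es]
        by (intro exI[of _ "take (Suc j) vs"] exI[of _ "take j es"]) auto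
    next
      case False
      from step(2) obtain e where e: "e \<in> A" "{tail G e, head G e} = {v, w}"
        unfolding links_def by blast
      show ?thesis
      proof (intro exI conjI allI impI)
        fix i assume "i < length (es @ [e])"
        then consider "i < length es" | "i = length es" by fastforce
        then show "{tail G ((es @ [e]) ! i), head G ((es @ [e]) ! i)}
            = {(vs @ [w]) ! i, (vs @ [w]) ! Suc i}"
          using p e by cases (auto simp: nth_append)
      qed (use p e False in \<open>auto simp: nth_append\<close>)
    qed
  qed

text \<open>A simple path from the head of \<open>e\<close> to its tail that avoids \<open>e\<close> is closed by \<open>e\<close> to an undirected
  cycle. If \<open>e\<close> is a loop, the path has no arc and the cycle is the loop itself.\<close>

lemma no_undirected_cycle_no_return:
  assumes acyclic: "\<nexists>vs es. undirected_cycle G vs es" and "e \<in> arcs G"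
  shows "(head G e, tail G e) \<notin> (links G (arcs G - {e}))\<^sup>*"
proof
  assume "(head G e, tail G e) \<in> (links G (arcs G - {e}))\<^sup>*"
  then obtain vs es where p: "length vs = Suc (length es)" "distinct vs" "vs ! 0 = head G e"
    "vs ! length es = tail G e" "set es \<subseteq> arcs G - {e}"
    "\<And>i. i < length es \<Longrightarrow> {tail G (es ! i), head G (es ! i)} = {vs ! i, vs ! Suc i}"
    by (blast dest: links_simple_path)
  have "es ! i \<noteq> es ! j" if "i < j" "j < length es" for i j
  proof
    assume "es ! i = es ! j"
    then have "{vs ! i, vs ! Suc i} = {vs ! j, vs ! Suc j}"
      using p(6)[of i] p(6)[of j] that by simp
    then have "vs ! i = vs ! j \<or> vs ! i = vs ! Suc j" by blast
    then show False using that p(1,2) by (auto simp: nth_eq_iff_index_eq)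
  qed
  then have "distinct es" by (metis distinct_conv_nth linorder_neqE_nat)
  moreover have "{tail G ((es @ [e]) ! i), head G ((es @ [e]) ! i)}
      = {vs ! i, vs ! (Suc i mod length (es @ [e]))}" if "i < length (es @ [e])" for i
  proof (cases "i < length es")
    case True
    then show ?thesis using p(6)[OF True] by (simp add: nth_append)
  next
    case False
    then have "i = length es" using that by simp
    then show ?thesis using p(3,4) by auto
  qed
  ultimately have "undirected_cycle G vs (es @ [e])"
    unfolding undirected_cycle_def using p(1,2,5) assms(2) by auto
  then show False using acyclic by blast
qed

text \<open>Removing \<open>e\<close> from the contracted forest separates its ends. The vertices of \<open>G\<close> in the parts on the
  side of the head form a cut that only \<open>e\<close> crosses.\<close>

lemma (in fin_digraph) circulation_0_between_parts:
  assumes acyclic: "\<nexists>vs es. undirected_cycle (contract G V m) vs es"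
    and circ: "\<And>v. v \<in> verts G \<Longrightarrow> net_outflow G h v = 0"
    and e: "e \<in> arcs G" "part_index V m (tail G e) \<noteq> part_index V m (head G e)"
  shows "h e = 0"
proof -
  let ?C = "contract G V m" and ?\<pi> = "part_index V m"
  let ?R = "(links ?C (arcs ?C - {e}))\<^sup>* `` {head ?C e}"
  let ?S = "{v \<in> verts G. ?\<pi> v \<in> ?R}"
  have eC: "e \<in> arcs ?C" using e by (simp add: contract_def)
  have head: "head ?C k = ?\<pi> (head G k)" and tail: "tail ?C k = ?\<pi> (tail G k)" for k
    by (simp_all add: contract_def)
  have closed: "(tail G k \<in> ?S) = (head G k \<in> ?S)" if "k \<in> arcs G" "k \<noteq> e" for k
  proof (cases "?\<pi> (tail G k) = ?\<pi> (head G k)")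
    case True
    then show ?thesis using that by auto
  next
    case False
    then have "k \<in> arcs ?C - {e}" using that by (simp add: contract_def)
    from links_closed[OF this, of "head ?C e" ?C] show ?thesis
      using that by (simp add: head tail)
  qed
  have "?\<pi> (tail G e) \<notin> ?R"
    using no_undirected_cycle_no_return[OF acyclic eC] by (simp add: tail)
  moreover have "?\<pi> (head G e) \<in> ?R" by (simp add: head)
  ultimately have "\<bar>h e\<bar> = \<bar>\<Sum>v\<in>?S. net_outflow G h v\<bar>"
    using e(1) closed by (intro flow_on_single_crossing_arc) auto
  also have "(\<Sum>v\<in>?S. net_outflow G h v) = 0" using circ by (intro sum.neutral) auto
  finally show ?thesis by simp
qed

section \<open>The relaxed problem\<close>

lemma compact_function_box:
  fixes K :: "'i \<Rightarrow> 'a::topological_space set"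
  assumes "\<And>i. compact (K i)"
  shows "compact {x. \<forall>i. x i \<in> K i}"
proof -
  have "compactin (product_topology (\<lambda>_. euclidean) UNIV) (PiE UNIV K)"
    using assms by (subst compactin_PiE) auto
  then have "compact (PiE UNIV K)" by (simp add: euclidean_product_topology)
  moreover have "PiE UNIV K = {x. \<forall>i. x i \<in> K i}" by auto
  ultimately show ?thesis by simp
qed

context power_network
begin

sublocale fin_digraph "net N" by (rule fin_digraph_net)

lemma relaxed_feasible_net_outflow:
  assumes "relaxed_feasible N l f p" "v \<in> verts (net N)"
  shows "net_outflow (net N) f v = (\<Sum>g\<in>{g \<in> gens N. gen_bus N g = v}. p g) + l v - demand N v"
proof -
  have "(\<Sum>k\<in>in_arcs (net N) v. f k) - (\<Sum>k\<in>out_arcs (net N) v. f k)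
        + (\<Sum>g\<in>{g \<in> gens N. gen_bus N g = v}. p g) + l v = demand N v"
    using assms unfolding relaxed_feasible_def by blast
  then show ?thesis unfolding net_outflow_def by simp
qed

lemma relaxed_feasible_cong:
  assumes "relaxed_feasible N l f p"
    and "\<And>v. v \<in> verts (net N) \<Longrightarrow> l' v = l v" "\<And>k. k \<in> arcs (net N) \<Longrightarrow> f' k = f k"
    and "\<And>g. g \<in> gens N \<Longrightarrow> p' g = p g"
  shows "relaxed_feasible N l' f' p'"
proof -
  have "(\<Sum>k\<in>in_arcs (net N) b. f' k) = (\<Sum>k\<in>in_arcs (net N) b. f k)"
    "(\<Sum>k\<in>out_arcs (net N) b. f' k) = (\<Sum>k\<in>out_arcs (net N) b. f k)"
    "(\<Sum>g\<in>{g \<in> gens N. gen_bus N g = b}. p' g) = (\<Sum>g\<in>{g \<in> gens N. gen_bus N g = b}. p g)" for b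
    using assms by (auto intro!: sum.cong)
  then show ?thesis using assms unfolding relaxed_feasible_def by simp
qed

text \<open>Feasibility and the objective do not depend on the values of \<open>l\<close>, \<open>f\<close> and \<open>p\<close> outside the network. With
  these set to zero, the feasible set is closed in a product of compact intervals, and Tychonoff's
  theorem applies to the whole function spaces.\<close>

lemma relaxed_minimum_attained:
  "\<exists>l f p. relaxed_feasible N l f p \<and> (\<forall>l' f' p'. relaxed_feasible N l' f' p' \<longrightarrow> total_shed N l \<le> total_shed N l')"
proof -
  let ?L = "\<lambda>v. if v \<in> verts (net N) then {0..demand N v} else {0}"
  let ?F = "\<lambda>k. if k \<in> arcs (net N) then {- thermal_limit N k..thermal_limit N k} else {0}"
  let ?P = "\<lambda>g. if g \<in> gens N then {0..max_dispatch N g} else {0}"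
  let ?box = "{l. \<forall>v. l v \<in> ?L v} \<times> {f. \<forall>k. f k \<in> ?F k} \<times> {p. \<forall>g. p g \<in> ?P g}"
  let ?bal = "\<lambda>x b. (\<Sum>k\<in>in_arcs (net N) b. fst (snd x) k) - (\<Sum>k\<in>out_arcs (net N) b. fst (snd x) k)
        + (\<Sum>g\<in>{g \<in> gens N. gen_bus N g = b}. snd (snd x) g) + fst x b"
  define C where "C = ?box \<inter> (\<Inter>b\<in>verts (net N). {x. ?bal x b = demand N b})"
  have coord: "continuous_on UNIV (\<lambda>x :: ('b \<Rightarrow> real) \<times> ('k \<Rightarrow> real) \<times> ('g \<Rightarrow> real). fst x b)"
    "continuous_on UNIV (\<lambda>x :: ('b \<Rightarrow> real) \<times> ('k \<Rightarrow> real) \<times> ('g \<Rightarrow> real). fst (snd x) k)"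
    "continuous_on UNIV (\<lambda>x :: ('b \<Rightarrow> real) \<times> ('k \<Rightarrow> real) \<times> ('g \<Rightarrow> real). snd (snd x) g)" for b k g
    by (rule continuous_on_product_then_coordinatewise[OF continuous_on_fst[OF continuous_on_id]]
      continuous_on_product_then_coordinatewise[OF continuous_on_fst[OF continuous_on_snd[OF continuous_on_id]]]
      continuous_on_product_then_coordinatewise[OF continuous_on_snd[OF continuous_on_snd[OF continuous_on_id]]])+
  have "compact ?box"
    by (intro compact_Times compact_function_box) auto
  moreover have "closed (\<Inter>b\<in>verts (net N). {x. ?bal x b = demand N b})"
    by (intro closed_INT ballI closed_Collect_eq continuous_intros coord)
  ultimately have "compact C" unfolding C_def by (rule compact_Int_closed)
  have mem: "(l, f, p) \<in> C \<longleftrightarrow> relaxed_feasible N l f p \<and>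
      (\<forall>v. v \<notin> verts (net N) \<longrightarrow> l v = 0) \<and> (\<forall>k. k \<notin> arcs (net N) \<longrightarrow> f k = 0) \<and>
      (\<forall>g. g \<notin> gens N \<longrightarrow> p g = 0)" for l f p
    unfolding relaxed_feasible_def C_def by (auto split: if_splits)
  have trunc: "\<exists>l' f' p'. (l', f', p') \<in> C \<and> total_shed N l' = total_shed N l"
    if "relaxed_feasible N l f p" for l f p
  proof -
    let ?l = "\<lambda>v. if v \<in> verts (net N) then l v else 0"
      and ?f = "\<lambda>k. if k \<in> arcs (net N) then f k else 0"
      and ?p = "\<lambda>g. if g \<in> gens N then p g else 0"
    have "relaxed_feasible N ?l ?f ?p" by (rule relaxed_feasible_cong[OF that]) auto
    then have "(?l, ?f, ?p) \<in> C" unfolding mem by auto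
    moreover have "total_shed N ?l = total_shed N l" unfolding total_shed_def by simp
    ultimately show ?thesis by blast
  qed
  have "relaxed_feasible N (demand N) (\<lambda>_. 0) (\<lambda>_. 0)"
    unfolding relaxed_feasible_def
    using demand_nonneg thermal_limit_nonneg max_dispatch_nonneg by simp
  from trunc[OF this] have "C \<noteq> {}" by blast
  moreover have "continuous_on C (\<lambda>x. total_shed N (fst x))"
    unfolding total_shed_def
    by (intro continuous_on_sum continuous_on_subset[OF coord(1)]) auto
  ultimately obtain x where x: "x \<in> C" "\<And>y. y \<in> C \<Longrightarrow> total_shed N (fst x) \<le> total_shed N (fst y)"
    using continuous_attains_inf[OF \<open>compact C\<close>] by blast
  obtain l f p where lfp: "x = (l, f, p)" by (cases x)
  have "relaxed_feasible N l f p" using x(1) unfolding lfp mem by blast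
  moreover have "total_shed N l \<le> total_shed N l'" if feas: "relaxed_feasible N l' f' p'" for l' f' p'
  proof -
    obtain l'' f'' p'' where "(l'', f'', p'') \<in> C" and eq: "total_shed N l'' = total_shed N l'"
      using trunc[OF feas] by blast
    from x(2)[OF this(1)] show ?thesis by (simp add: lfp eq)
  qed
  ultimately show ?thesis by blast
qed

text \<open>A bus absorbs at most its demand, so a set of buses absorbs at most the total demand. It also emits
  at most the total demand, since what it emits is absorbed by its complement.\<close>

lemma cut_injection_le_demand:
  assumes "relaxed_feasible N l f p" "S \<subseteq> verts (net N)"
  shows "\<bar>\<Sum>v\<in>S. net_outflow (net N) f v\<bar> \<le> demand_norm1 N"
proof -
  let ?s = "net_outflow (net N) f"
  have lower: "- demand_norm1 N \<le> (\<Sum>v\<in>T. ?s v)" if "T \<subseteq> verts (net N)" for T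
  proof -
    have s: "- demand N v \<le> ?s v" if "v \<in> verts (net N)" for v
    proof -
      have "0 \<le> (\<Sum>g\<in>{g \<in> gens N. gen_bus N g = v}. p g)"
        using assms(1) unfolding relaxed_feasible_def by (intro sum_nonneg) auto
      moreover have "0 \<le> l v" using assms(1) that unfolding relaxed_feasible_def by auto
      ultimately show ?thesis using relaxed_feasible_net_outflow[OF assms(1) that] by simp
    qed
    have "(\<Sum>v\<in>T. demand N v) \<le> demand_norm1 N"
      unfolding demand_norm1_def
      using that finite_verts demand_nonneg
      by (intro order_trans[OF sum_mono[of T _ "\<lambda>v. \<bar>demand N v\<bar>"] sum_mono2]) auto
    moreover have "(\<Sum>v\<in>T. - demand N v) \<le> (\<Sum>v\<in>T. ?s v)"
      using s that by (intro sum_mono) auto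
    ultimately show ?thesis by (simp add: sum_negf)
  qed
  have "(\<Sum>v\<in>verts (net N) - S. ?s v) = - (\<Sum>v\<in>S. ?s v)"
    using sum_net_outflow_eq_0[of f] sum_diff[OF finite_verts assms(2), of ?s] by simp
  then show ?thesis using lower[OF assms(2)] lower[of "verts (net N) - S"] by auto
qed

section \<open>Phase angles for a relaxed solution\<close>

lemma ex_dc_feasible:
  fixes V :: "nat \<Rightarrow> 'b set"
  assumes conn: "Digraph_Component.connected (net N)"
    and cover: "verts (net N) = (\<Union>i\<in>{1..m}. V i)"
    and disj: "\<And>i j. i \<in> {1..m} \<Longrightarrow> j \<in> {1..m} \<Longrightarrow> i \<noteq> j \<Longrightarrow> V i \<inter> V j = {}"
    and tree: "undirected_tree (contract (net N) V m)"
    and limit: "\<And>k. k \<in> arcs (net N) \<Longrightarrow>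
      thermal_limit N k \<ge>
        sqrt (max_susceptance N / min_susceptance N)
        * sqrt (real (Max ((\<lambda>i. card (V i)) ` {1..m})) - 1)
        * demand_norm1 N"
    and feas: "relaxed_feasible N l f p"
  shows "\<exists>f' \<theta>. dc_feasible N l f' p \<theta>"
proof -
  let ?G = "net N" and ?D = "demand_norm1 N" and ?B = "susceptance N"
  let ?r = "Max ((\<lambda>i. card (V i)) ` {1..m})"
  let ?Bmax = "max_susceptance N" and ?Bmin = "min_susceptance N"
  have acyclic: "\<nexists>vs es. undirected_cycle (contract ?G V m) vs es"
    using tree unfolding undirected_tree_def by blast
  have part: "part_index V m v = i" if "i \<in> {1..m}" "v \<in> V i" for v i
    unfolding part_index_def using that disj[of _ i] by (intro the_equality) auto
  obtain \<theta> where \<theta>: "\<And>v. v \<in> verts ?G \<Longrightarrow>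
      net_outflow ?G (\<lambda>k. ?B k * (\<theta> (tail ?G k) - \<theta> (head ?G k))) v = net_outflow ?G f v"
    using ex_potential_flow[OF conn, of ?B, OF susceptance_pos sum_net_outflow_eq_0[of f]] by blast
  define f' where "f' k = ?B k * (\<theta> (tail ?G k) - \<theta> (head ?G k))" for k
  have f': "net_outflow ?G f' v = net_outflow ?G f v" if "v \<in> verts ?G" for v
    using \<theta>[OF that] unfolding f'_def .
  obtain g where free: "circulation_free ?G {k \<in> arcs ?G. g k \<noteq> 0}"
    and g: "\<And>v. v \<in> verts ?G \<Longrightarrow> net_outflow ?G g v = net_outflow ?G f v"
    using ex_circulation_free_flow[of f] by blast
  have g_le: "\<bar>g k\<bar> \<le> ?D" if "k \<in> arcs ?G" for k
  proof (rule circulation_free_flow_bound[OF free _ that])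
    fix S assume S: "S \<subseteq> verts ?G"
    have "(\<Sum>v\<in>S. net_outflow ?G g v) = (\<Sum>v\<in>S. net_outflow ?G f v)"
      using S g by (intro sum.cong) auto
    then show "\<bar>\<Sum>v\<in>S. net_outflow ?G g v\<bar> \<le> ?D" using cut_injection_le_demand[OF feas S] by simp
  qed
  have between: "f' k = h k"
    if h: "\<And>v. v \<in> verts ?G \<Longrightarrow> net_outflow ?G h v = net_outflow ?G f v" and k: "k \<in> arcs ?G"
      and parts: "part_index V m (tail ?G k) \<noteq> part_index V m (head ?G k)" for h k
    using circulation_0_between_parts[OF acyclic _ k parts, of "\<lambda>k. f' k - h k"] f' h
    by (simp add: net_outflow_diff)
  have "\<bar>f' e\<bar> \<le> thermal_limit N e" if e: "e \<in> arcs ?G" for e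
  proof (cases "part_index V m (tail ?G e) = part_index V m (head ?G e)")
    case False
    then have "f' e = f e" using between[of f] e by simp
    moreover have "\<bar>f e\<bar> \<le> thermal_limit N e" using feas e unfolding relaxed_feasible_def by auto
    ultimately show ?thesis by simp
  next
    case True
    obtain i where i: "i \<in> {1..m}" "tail ?G e \<in> V i" using cover tail_in_verts[OF e] by auto
    obtain j where j: "j \<in> {1..m}" "head ?G e \<in> V j" using cover head_in_verts[OF e] by auto
    have "i = j" using True part i j by simp
    define U where "U = V i"
    have "U \<subseteq> verts ?G" using i(1) cover unfolding U_def by blast
    then have U: "tail ?G e \<in> U" "head ?G e \<in> U" "finite U"
      using i j \<open>i = j\<close> finite_subset[OF _ finite_verts] by (auto simp: U_def)
    let ?A = "{k \<in> arcs ?G. tail ?G k \<in> U \<and> head ?G k \<in> U}"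
    let ?T = "{k \<in> ?A. g k \<noteq> 0}"
    have Bmin: "?Bmin \<le> ?B k" "?B k \<le> ?Bmax" if "k \<in> arcs ?G" for k
      using that by (auto simp: min_susceptance_def max_susceptance_def)
    have "?Bmin \<in> ?B ` arcs ?G"
      unfolding min_susceptance_def using e by (intro Min_in) auto
    then have Bmin_pos: "?Bmin > 0" using susceptance_pos by auto
    have boundary: "f' k = g k" if k: "k \<in> arcs ?G" "(tail ?G k \<in> U) \<noteq> (head ?G k \<in> U)" for k
    proof (rule between[OF g k(1)])
      show "part_index V m (tail ?G k) \<noteq> part_index V m (head ?G k)"
      proof
        assume eq: "part_index V m (tail ?G k) = part_index V m (head ?G k)"
        obtain a where a: "a \<in> {1..m}" "tail ?G k \<in> V a" using cover tail_in_verts[OF k(1)] by auto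
        obtain b where b: "b \<in> {1..m}" "head ?G k \<in> V b" using cover head_in_verts[OF k(1)] by auto
        have "a = b" using eq part a b by simp
        then show False using k(2) a b disj[of i a] i unfolding U_def by (cases "a = i") auto
      qed
    qed
    have "circulation_free ?G ?T"
      using free unfolding circulation_free_def by blast
    then have "card ?T \<le> card U - 1"
      using U by (intro circulation_free_card) auto
    moreover have "card U \<le> ?r" using i(1) unfolding U_def by (intro Max_ge) auto
    moreover have "card U \<ge> 1" using U by (metis One_nat_def Suc_leI card_gt_0_iff empty_iff)
    ultimately have card_T: "real (card ?T) \<le> real ?r - 1" by linarith
    have "(f' e)\<^sup>2 / ?B e \<le> (\<Sum>k\<in>?A. (f' k)\<^sup>2 / ?B k)"
      using e U susceptance_pos by (intro member_le_sum) (auto simp: less_imp_le)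
    also have "\<dots> \<le> (\<Sum>k\<in>?A. (g k)\<^sup>2 / ?B k)"
      by (rule block_energy_le[of ?B f' \<theta> g U]) (simp_all add: susceptance_pos f'_def[symmetric] f' g boundary)
    also have "\<dots> = (\<Sum>k\<in>?T. (g k)\<^sup>2 / ?B k)"
      by (intro sum.mono_neutral_right) auto
    also have "\<dots> \<le> (\<Sum>k\<in>?T. ?D\<^sup>2 / ?Bmin)"
      using Bmin Bmin_pos g_le by (intro sum_mono frac_le) (auto simp: abs_le_square_iff[symmetric] demand_norm1_def)
    also have "\<dots> = real (card ?T) * (?D\<^sup>2 / ?Bmin)" by simp
    also have "\<dots> \<le> (real ?r - 1) * (?D\<^sup>2 / ?Bmin)"
      using card_T Bmin_pos by (intro mult_right_mono) auto
    finally have energy: "(f' e)\<^sup>2 / ?B e \<le> (real ?r - 1) * (?D\<^sup>2 / ?Bmin)" .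
    have "(f' e)\<^sup>2 = ?B e * ((f' e)\<^sup>2 / ?B e)" using susceptance_pos[OF e] by simp
    also have "\<dots> \<le> ?Bmax * ((real ?r - 1) * (?D\<^sup>2 / ?Bmin))"
      using energy Bmin[OF e] susceptance_pos[OF e] by (intro mult_mono) (auto simp: less_imp_le)
    also have "\<dots> = ?Bmax / ?Bmin * (real ?r - 1) * ?D\<^sup>2" by simp
    finally have "sqrt ((f' e)\<^sup>2) \<le> sqrt (?Bmax / ?Bmin * (real ?r - 1) * ?D\<^sup>2)"
      by (rule real_sqrt_le_mono)
    also have "\<dots> = sqrt (?Bmax / ?Bmin) * sqrt (real ?r - 1) * ?D"
    proof -
      have "?D \<ge> 0" unfolding demand_norm1_def by (simp add: sum_nonneg)
      then show ?thesis unfolding real_sqrt_mult by simp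
    qed
    also have "\<dots> \<le> thermal_limit N e" by (rule limit[OF e])
    finally show ?thesis by simp
  qed
  then have limits: "\<forall>k\<in>arcs ?G. - thermal_limit N k \<le> f' k \<and> f' k \<le> thermal_limit N k"
    by (fastforce simp: abs_le_iff)
  have "(\<Sum>k\<in>in_arcs ?G b. f' k) - (\<Sum>k\<in>out_arcs ?G b. f' k)
        + (\<Sum>g\<in>{g \<in> gens N. gen_bus N g = b}. p g) + l b = demand N b" if "b \<in> verts ?G" for b
    using f'[OF that] relaxed_feasible_net_outflow[OF feas that] unfolding net_outflow_def by simp
  then have "relaxed_feasible N l f' p"
    using feas limits unfolding relaxed_feasible_def by blast
  then show ?thesis unfolding dc_feasible_def f'_def by blast
qed

end

theorem mainTheorem2:
  fixes N :: "('b, 'k, 'g) power_network"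
    and V :: "nat \<Rightarrow> 'b set"
    and m :: nat
  assumes "power_network N"
    and "Digraph_Component.connected (net N)"
    and "verts (net N) = (\<Union>i\<in>{1..m}. V i)"
    and "\<And>i j. i \<in> {1..m} \<Longrightarrow> j \<in> {1..m} \<Longrightarrow> i \<noteq> j \<Longrightarrow> V i \<inter> V j = {}"
    and "undirected_tree (contract (net N) V m)"
    and "\<And>k. k \<in> arcs (net N) \<Longrightarrow>
      thermal_limit N k \<ge>
        sqrt (max_susceptance N / min_susceptance N)
        * sqrt (real (Max ((\<lambda>i. card (V i)) ` {1..m})) - 1)
        * demand_norm1 N"
  shows "dc_optimum N \<in> dc_sheds N
    \<and> relaxed_optimum N \<in> relaxed_sheds N
    \<and> dc_optimum N = relaxed_optimum N"
proof -
  interpret power_network N by (rule assms(1))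
  have "\<exists>f' \<theta>. dc_feasible N l f' p \<theta>" if "relaxed_feasible N l f p" for l f p
    using ex_dc_feasible[OF assms(2-6) that] .
  then have sheds: "dc_sheds N = relaxed_sheds N"
    unfolding dc_sheds_def relaxed_sheds_def by (auto simp: dc_feasible_def) blast
  obtain l f p where opt: "relaxed_feasible N l f p"
    "\<And>l' f' p'. relaxed_feasible N l' f' p' \<Longrightarrow> total_shed N l \<le> total_shed N l'"
    using relaxed_minimum_attained by blast
  have mem: "total_shed N l \<in> relaxed_sheds N"
    using opt(1) unfolding relaxed_sheds_def by blast
  moreover have "relaxed_optimum N = total_shed N l"
    unfolding relaxed_optimum_def
    using mem opt(2) by (intro cInf_eq_minimum) (auto simp: relaxed_sheds_def)
  ultimately show ?thesis unfolding dc_optimum_def sheds relaxed_optimum_def by simp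
qed

end
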